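(* Let $A$ be a real $M\times N$ matrix with transpose $A^*$ and let $a_j<b_j$ be real numbers for $j=1,\dots,N$. For $\lambda\in\mathbb{R}^M$ let $x(\lambda)\in\mathbb{R}^N$ be the vector $$x_j(\lambda)=\frac{a_je^{-a_j(A^*\lambda)_j}+b_je^{-b_j(A^*\lambda)_j}}{e^{-a_j(A^*\lambda)_j}+e^{-b_j(A^*\lambda)_j}},\qquad j=1,\dots,N,$$ and let $C=C(\lambda)$ be the $N\times N$ diagonal matrix with diagonal entries $$C_{jj}=\left(\frac{b_j-a_j}{e^{(b_j-a_j)(A^*\lambda)_j/2}+e^{-(b_j-a_j)(A^*\lambda)_j/2}}\right)^2 .$$ Let $U\subset\mathbb{R}^M$ be open and let $y\mapsto\lambda(y)\in\mathbb{R}^M$ be the Lagrange multiplier as a function of the data $y\in U$, i.e. $A\,x(\lambda(y))=y$ for all $y\in U$. If at $y\in U$ the (positive semidefinite) matrix $ACA^*$, with $C=C(\lambda(y))$, is invertible, then the Jacobian matrix of $\lambda$ with respect to $y$ at that point is $$\frac{\partial(\lambda)}{\partial(y)}=-\left(ACA^*\right)^{-1}.$$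
   Context: The setting is the problem of minimizing $\Psi(x)$ over $x\in\prod_{j=1}^N[a_j,b_j]$ subject to $Ax=y$, where, with $D_j=b_j-a_j$ and $0\ln0=0$, $$\Psi(x)=\sum_{j=1}^N\left[\frac{x_j-a_j}{D_j}\ln\left(\frac{x_j-a_j}{D_j}\right)+\frac{b_j-x_j}{D_j}\ln\left(\frac{b_j-x_j}{D_j}\right)\right].$$ The Lagrange multiplier $\lambda$ is taken with respect to the Lagrangian $\mathcal{L}(x,\lambda,y)=\Psi(x)+\lambda^t(Ax-y)$, whose minimizer in $x$ for given $\lambda$ is the $x(\lambda)$ displayed in the claim; the condition determining $\lambda$ is $Ax(\lambda)=y$. The Jacobian matrix $\frac{\partial(\lambda)}{\partial(y)}$ is the $M\times M$ matrix with $(k,m)$ entry $\frac{\partial\lambda_m}{\partial y_k}$. *)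

theory Defs
  imports "HOL-Analysis.Analysis"
begin

definition x_of :: "real ^ 'n ^ 'm \<Rightarrow> real ^ 'n \<Rightarrow> real ^ 'n \<Rightarrow> real ^ 'm \<Rightarrow> real ^ 'n" where
  "x_of A a b l = (\<chi> j. let t = (transpose A *v l) $ j in
     (a $ j * exp (- (a $ j * t)) + b $ j * exp (- (b $ j * t))) /
     (exp (- (a $ j * t)) + exp (- (b $ j * t))))"

definition C_of :: "real ^ 'n ^ 'm \<Rightarrow> real ^ 'n \<Rightarrow> real ^ 'n \<Rightarrow> real ^ 'm \<Rightarrow> real ^ 'n ^ 'n" where
  "C_of A a b l = (\<chi> i j. if i = j then
     (let t = (transpose A *v l) $ j in
       ((b $ j - a $ j) /
        (exp ((b $ j - a $ j) * t / 2) + exp (- ((b $ j - a $ j) * t / 2))))\<^sup>2)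
     else 0)"

lemma ACA_positive_semidefinite:
  fixes A :: "real ^ 'n ^ 'm"
  shows "0 \<le> v \<bullet> ((A ** C_of A a b l ** transpose A) *v v)"
proof -
  define w where "w = transpose A *v v"
  define D where "D = C_of A a b l"
  have D: "D $ i $ j = 0" if "i \<noteq> j" for i j
    using that by (simp add: D_def C_of_def)
  have "(A ** D ** transpose A) *v v = A *v (D *v w)"
    by (simp only: w_def matrix_vector_mul_assoc matrix_mul_assoc)
  then have "v \<bullet> ((A ** D ** transpose A) *v v) = w \<bullet> (D *v w)"
    by (simp add: w_def dot_lmul_matrix [symmetric])
  also have "\<dots> = (\<Sum>i\<in>UNIV. w $ i * (\<Sum>j\<in>UNIV. D $ i $ j * w $ j))"
    by (simp add: inner_vec_def matrix_vector_mult_def)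
  also have "\<dots> = (\<Sum>i\<in>UNIV. D $ i $ i * (w $ i)\<^sup>2)"
  proof (rule sum.cong)
    fix i
    have "(\<Sum>j\<in>UNIV. D $ i $ j * w $ j) = (\<Sum>j\<in>{i}. D $ i $ j * w $ j)"
      by (rule sum.mono_neutral_right) (auto simp: D)
    then show "w $ i * (\<Sum>j\<in>UNIV. D $ i $ j * w $ j) = D $ i $ i * (w $ i)\<^sup>2"
      by (simp add: power2_eq_square)
  qed simp
  also have "\<dots> \<ge> 0"
    by (intro sum_nonneg mult_nonneg_nonneg) (auto simp: D_def C_of_def Let_def)
  finally show ?thesis unfolding D_def .
qed

text \<open>
  The Jacobian matrix \<open>\<partial>(\<lambda>)/\<partial>(y)\<close> has \<open>(k,m)\<close> entry \<open>\<partial>\<lambda>\<^sub>m/\<partial>y\<^sub>k\<close>.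
  This is the transpose of the library's \<^const>\<open>jacobian\<close>, whose rows are
  indexed by the components of the function.
\<close>

lemma transpose_jacobian_partial:
  fixes f :: "real ^ 'p \<Rightarrow> real ^ 'q"
  assumes "f differentiable (at y)"
  shows "((\<lambda>t. f (y + t *\<^sub>R axis k 1) $ m) has_real_derivative
           transpose (jacobian f (at y)) $ k $ m) (at 0)"
proof -
  have "(f has_derivative (\<lambda>h. jacobian f (at y) *v h)) (at (y + 0 *\<^sub>R axis k 1))"
    using assms by (simp add: jacobian_works)
  moreover have "((\<lambda>t. y + t *\<^sub>R axis k 1) has_derivative (\<lambda>t. t *\<^sub>R axis k 1)) (at (0::real))"
    by (auto intro!: derivative_eq_intros)
  ultimately have "((\<lambda>t. f (y + t *\<^sub>R axis k 1)) has_derivative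
      (\<lambda>t. jacobian f (at y) *v (t *\<^sub>R axis k 1))) (at (0::real))"
    by (rule has_derivative_compose[rotated])
  then have "((\<lambda>t. f (y + t *\<^sub>R axis k 1) $ m) has_derivative
      (\<lambda>t. (jacobian f (at y) *v (t *\<^sub>R axis k 1)) $ m)) (at (0::real))"
    by (rule bounded_linear.has_derivative[OF bounded_linear_vec_nth])
  then show ?thesis
    by (simp add: has_field_derivative_def matrix_vector_mult_scaleR
        matrix_vector_mult_basis column_def transpose_def mult_commute_abs)
qed

end

theory Submission
  imports Defs
begin

text \<open>
  Write \<open>G(l) = A x(l)\<close>, so that the multiplier satisfies \<open>G(\<lambda>(z)) = z\<close> on \<open>U\<close>. The \<open>j\<close>-th component
  of \<open>x(l)\<close> is the mean \<open>\<phi>\<^sub>j(t)\<close>, at \<open>t = (A\<^sup>*l)\<^sub>j\<close>, of the Gibbs distribution on the two points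
  \<open>a\<^sub>j, b\<^sub>j\<close> with weights proportional to \<open>e\<^sup>-\<^sup>a\<^sup>t\<close> and \<open>e\<^sup>-\<^sup>b\<^sup>t\<close>. The derivative of such a mean is
  minus the variance, and this variance is \<open>C\<^sub>j\<^sub>j > 0\<close>. The chain rule then gives
  \<open>DG(l) = - A C(l) A\<^sup>*\<close>.

  Differentiating \<open>G(\<lambda>(z)) = z\<close> would finish the argument if \<open>\<lambda>\<close> were known to be differentiable.
  No regularity of \<open>\<lambda>\<close>, not even continuity, is given, so it has to come from \<open>G\<close>. It does,
  because \<open>G\<close> is globally injective: each \<open>\<phi>\<^sub>j\<close> is strictly decreasing, hence \<open>G(l) = G(l')\<close> forces
  \<open>A\<^sup>*l = A\<^sup>*l'\<close>, and invertibility of \<open>A C A\<^sup>*\<close> at a single point makes \<open>A\<^sup>*\<close> injective. Therefore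
  \<open>\<lambda>\<close> coincides on \<open>U\<close> with the inverse function of \<open>G\<close>, and the inverse of an injective continuous
  map between spaces of the same dimension is differentiable wherever the map has an invertible
  derivative. Finally, \<open>A C A\<^sup>*\<close> is symmetric, so transposing the Jacobian changes nothing.
\<close>

definition gibbs_mean :: "real \<Rightarrow> real \<Rightarrow> real \<Rightarrow> real" where
  "gibbs_mean a b t =
     (a * exp (- (a * t)) + b * exp (- (b * t))) / (exp (- (a * t)) + exp (- (b * t)))"

text \<open>
  The variance of the same distribution: with \<open>P\<close> and \<open>Q\<close> the two weights, it is
  \<open>(b - a)\<^sup>2 P Q / (P + Q)\<^sup>2\<close>, and cancelling the geometric mean of \<open>P\<close> and \<open>Q\<close> gives the
  symmetric form below.
\<close>

definition gibbs_variance :: "real \<Rightarrow> real \<Rightarrow> real \<Rightarrow> real" where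
  "gibbs_variance a b t =
     ((b - a) / (exp ((b - a) * t / 2) + exp (- ((b - a) * t / 2))))\<^sup>2"

lemma x_of_nth: "x_of A a b l $ j = gibbs_mean (a $ j) (b $ j) ((transpose A *v l) $ j)"
  by (simp add: x_of_def gibbs_mean_def Let_def)

lemma C_of_mult_nth:
  "(C_of A a b l *v w) $ j = gibbs_variance (a $ j) (b $ j) ((transpose A *v l) $ j) * w $ j"
proof -
  have "(C_of A a b l *v w) $ j = (\<Sum>k\<in>UNIV. if j = k
      then gibbs_variance (a $ k) (b $ k) ((transpose A *v l) $ k) * w $ k else 0)"
    unfolding matrix_vector_mult_def [of "C_of A a b l"] vec_lambda_beta
    by (rule sum.cong) (auto simp: C_of_def gibbs_variance_def Let_def)
  then show ?thesis
    by simp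
qed

lemma transpose_C_of: "transpose (C_of A a b l) = C_of A a b l"
  by (simp add: transpose_def C_of_def vec_eq_iff)

lemma gibbs_variance_pos:
  assumes "a < b"
  shows "gibbs_variance a b t > 0"
proof -
  have "exp ((b - a) * t / 2) + exp (- ((b - a) * t / 2)) > 0"
    by (simp add: add_pos_pos)
  then show ?thesis
    using assms by (simp add: gibbs_variance_def)
qed

lemma gibbs_variance_eq:
  "gibbs_variance a b t =
     (b - a)\<^sup>2 * (exp (- (a * t)) * exp (- (b * t))) / (exp (- (a * t)) + exp (- (b * t)))\<^sup>2"
proof -
  define s E F where "s = exp (- ((a + b) * t / 2))"
    and "E = exp ((b - a) * t / 2)" and "F = exp (- ((b - a) * t / 2))"
  have P: "exp (- (a * t)) = s * E" and Q: "exp (- (b * t)) = s * F" and EF: "E * F = 1"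
    by (simp_all add: s_def E_def F_def exp_add [symmetric] field_simps)
  have "s > 0"
    by (simp add: s_def)
  have "(b - a)\<^sup>2 * (s * E * (s * F)) / (s * E + s * F)\<^sup>2
      = (b - a)\<^sup>2 * (s\<^sup>2 * (E * F)) / (s\<^sup>2 * (E + F)\<^sup>2)"
    by (simp add: power2_eq_square algebra_simps)
  also have "\<dots> = ((b - a) / (E + F))\<^sup>2"
    using \<open>s > 0\<close> by (simp add: EF power_divide)
  finally show ?thesis
    by (simp add: gibbs_variance_def P Q E_def F_def)
qed

text \<open>
  The mean is minus the logarithmic derivative of the partition function
  \<open>e\<^sup>-\<^sup>a\<^sup>t + e\<^sup>-\<^sup>b\<^sup>t\<close>, so its derivative is minus the second cumulant.
\<close>

lemma gibbs_mean_has_derivative: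
  "(gibbs_mean a b has_real_derivative - gibbs_variance a b t) (at t)"
proof -
  define P Q where "P = (\<lambda>t. exp (- (a * t)))" and "Q = (\<lambda>t. exp (- (b * t)))"
  have P: "(P has_real_derivative - (a * P t)) (at t)"
    and Q: "(Q has_real_derivative - (b * Q t)) (at t)"
    unfolding P_def Q_def by (auto intro!: derivative_eq_intros)
  have "P t > 0" "Q t > 0"
    by (simp_all add: P_def Q_def)
  then have pos: "P t + Q t \<noteq> 0"
    by linarith
  have "((\<lambda>t. (a * P t + b * Q t) / (P t + Q t)) has_real_derivative
      ((a * - (a * P t) + b * - (b * Q t)) * (P t + Q t)
        - (a * P t + b * Q t) * (- (a * P t) + - (b * Q t))) / ((P t + Q t) * (P t + Q t))) (at t)"
    by (intro DERIV_divide DERIV_add DERIV_cmult P Q pos)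
  moreover have "(a * - (a * P t) + b * - (b * Q t)) * (P t + Q t)
        - (a * P t + b * Q t) * (- (a * P t) + - (b * Q t)) = - ((b - a)\<^sup>2 * (P t * Q t))"
    by (simp add: algebra_simps power2_eq_square)
  moreover have "gibbs_mean a b = (\<lambda>t. (a * P t + b * Q t) / (P t + Q t))"
    by (simp add: gibbs_mean_def P_def Q_def fun_eq_iff)
  ultimately show ?thesis
    by (simp add: gibbs_variance_eq P_def Q_def power2_eq_square)
qed

lemma gibbs_mean_strict_decreasing:
  assumes "a < b" "s < t"
  shows "gibbs_mean a b t < gibbs_mean a b s"
proof (rule DERIV_neg_imp_decreasing [OF \<open>s < t\<close>])
  fix u
  show "\<exists>d. (gibbs_mean a b has_real_derivative d) (at u) \<and> d < 0"
    using gibbs_mean_has_derivative [of a b u] gibbs_variance_pos [OF \<open>a < b\<close>, of u] by force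
qed

lemma constraint_map_has_derivative:
  fixes A :: "real ^ 'n ^ 'm"
  shows "((\<lambda>l. A *v x_of A a b l) has_derivative
           (\<lambda>h. - ((A ** C_of A a b l ** transpose A) *v h))) (at l)"
proof -
  let ?T = "\<lambda>l. transpose A *v l"
  have comp: "((\<lambda>l. x_of A a b l $ j) has_derivative
      (\<lambda>h. (- (C_of A a b l *v ?T h)) $ j)) (at l)" for j
  proof -
    have "(?T has_derivative ?T) (at l)"
      by (intro bounded_linear_imp_has_derivative matrix_vector_mul_bounded_linear)
    then have T: "((\<lambda>l. ?T l $ j) has_derivative (\<lambda>h. ?T h $ j)) (at l)"
      by (rule bounded_linear.has_derivative [OF bounded_linear_vec_nth])
    show ?thesis
      using DERIV_compose_FDERIV [OF gibbs_mean_has_derivative T, of "a $ j" "b $ j"]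
      by (simp add: x_of_nth C_of_mult_nth mult.commute)
  qed
  have "(x_of A a b has_derivative (\<lambda>h. - (C_of A a b l *v ?T h))) (at l)"
    unfolding has_derivative_componentwise_within [where f = "x_of A a b"]
    using comp by (auto simp: Basis_vec_def inner_axis)
  then have "((\<lambda>l. A *v x_of A a b l) has_derivative
      (\<lambda>h. A *v (- (C_of A a b l *v ?T h)))) (at l)"
    by (rule bounded_linear.has_derivative [OF matrix_vector_mul_bounded_linear])
  moreover have "A *v (- (C_of A a b l *v ?T h)) = - ((A ** C_of A a b l ** transpose A) *v h)" for h
    by (simp add: linear_neg [OF matrix_vector_mul_linear] matrix_vector_mul_assoc matrix_mul_assoc
        del: transpose_matrix_vector)
  ultimately show ?thesis
    by simp
qed

text \<open>
  The pairing \<open>(l - l') \<bullet> (G(l) - G(l'))\<close> is the sum over \<open>j\<close> of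
  \<open>(t\<^sub>j - t'\<^sub>j) (\<phi>\<^sub>j(t\<^sub>j) - \<phi>\<^sub>j(t'\<^sub>j))\<close>. As the \<open>\<phi>\<^sub>j\<close> decrease strictly, every term is
  nonpositive and vanishes only when \<open>t\<^sub>j = t'\<^sub>j\<close>.
\<close>

lemma constraint_map_eq_imp:
  fixes A :: "real ^ 'n ^ 'm"
  assumes ab: "\<And>j. a $ j < b $ j"
    and eq: "A *v x_of A a b l = A *v x_of A a b l'"
  shows "transpose A *v l = transpose A *v l'"
proof -
  define t t' where "t = transpose A *v l" and "t' = transpose A *v l'"
  define d where "d j = (t $ j - t' $ j) *
    (gibbs_mean (a $ j) (b $ j) (t' $ j) - gibbs_mean (a $ j) (b $ j) (t $ j))" for j
  have d_nonneg: "d j \<ge> 0" and d_zero: "d j = 0 \<Longrightarrow> t $ j = t' $ j" for j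
    using gibbs_mean_strict_decreasing [OF ab [of j], of "t $ j" "t' $ j"]
      gibbs_mean_strict_decreasing [OF ab [of j], of "t' $ j" "t $ j"]
    by (cases "t $ j" "t' $ j" rule: linorder_cases;
        auto simp: d_def intro: mult_nonneg_nonneg mult_nonpos_nonpos)+
  have "(\<Sum>j\<in>UNIV. d j) = (t - t') \<bullet> (x_of A a b l' - x_of A a b l)"
    by (simp add: inner_vec_def d_def x_of_nth t_def t'_def)
  also have "\<dots> = (l - l') \<bullet> (A *v (x_of A a b l' - x_of A a b l))"
    by (simp add: t_def t'_def dot_lmul_matrix [symmetric] matrix_vector_mult_diff_distrib [symmetric]
        del: transpose_matrix_vector)
       (simp add: dot_lmul_matrix)
  also have "\<dots> = 0"
    using eq by (simp add: matrix_vector_mult_diff_distrib)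
  finally have "\<forall>j. d j = 0"
    using d_nonneg by (simp add: sum_nonneg_eq_0_iff)
  then show ?thesis
    using d_zero by (simp add: vec_eq_iff t_def t'_def)
qed

text \<open>
  Only the kernel of \<open>A\<^sup>*\<close> matters, and any invertible product \<open>A B A\<^sup>*\<close> shows it to be trivial.
  This is how invertibility at one multiplier yields injectivity at all of them.
\<close>

lemma constraint_map_inj:
  fixes A :: "real ^ 'n ^ 'm" and B :: "real ^ 'n ^ 'n"
  assumes "\<And>j. a $ j < b $ j" and inv: "invertible (A ** B ** transpose A)"
  shows "inj (\<lambda>l. A *v x_of A a b l)"
proof (rule injI)
  fix l l' assume "A *v x_of A a b l = A *v x_of A a b l'"
  then have "transpose A *v l = transpose A *v l'"
    by (rule constraint_map_eq_imp [OF assms(1)])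
  then have "(A ** B ** transpose A) *v l = (A ** B ** transpose A) *v l'"
    by (simp only: matrix_vector_mul_assoc [symmetric])
  then show "l = l'"
    using inv by (metis inj_matrix_vector_mult injD)
qed

lemma invertible_matrix_inv:
  assumes "invertible M"
  shows "M ** matrix_inv M = mat 1" "matrix_inv M ** M = mat 1"
  using someI_ex [OF assms [unfolded invertible_def]] by (simp_all add: matrix_inv_def)

lemma transpose_matrix_inv_of_symmetric:
  fixes M :: "real ^ 'n ^ 'n"
  assumes "invertible M" "transpose M = M"
  shows "transpose (matrix_inv M) = matrix_inv M"
proof -
  have "transpose (matrix_inv M) ** M = mat 1"
    using arg_cong [OF invertible_matrix_inv(1) [OF assms(1)], of transpose] assms(2)
    by (simp add: matrix_transpose_mul)
  then show ?thesis
    by (metis assms(1) invertible_matrix_inv(1) matrix_mul_assoc matrix_mul_lid matrix_mul_rid)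
qed

theorem theorem4p1:
  fixes A :: "real ^ 'n ^ 'm"
    and a b :: "real ^ 'n"
    and U :: "(real ^ 'm) set"
    and lam :: "real ^ 'm \<Rightarrow> real ^ 'm"
    and y :: "real ^ 'm"
  assumes "\<And>j. a $ j < b $ j"
    and "open U"
    and "\<And>z. z \<in> U \<Longrightarrow> A *v x_of A a b (lam z) = z"
    and "y \<in> U"
    and "invertible (A ** C_of A a b (lam y) ** transpose A)"
  shows "lam differentiable (at y) \<and>
         transpose (jacobian lam (at y)) =
           - matrix_inv (A ** C_of A a b (lam y) ** transpose A)"
proof -
  define M where "M = A ** C_of A a b (lam y) ** transpose A"
  define G where "G = (\<lambda>l. A *v x_of A a b l)"
  have M_inv: "invertible M"
    using assms(5) by (simp add: M_def)
  have M_sym: "transpose M = M"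
    by (simp add: M_def matrix_transpose_mul transpose_C_of matrix_mul_assoc)
  have G_lam: "G (lam z) = z" if "z \<in> U" for z
    using assms(3) that by (simp add: G_def)
  have inj: "inj G"
    unfolding G_def using constraint_map_inj [OF assms(1) assms(5)] .
  have inv_G: "inv G z = lam z" if "z \<in> U" for z
    using inj G_lam [OF that] by (metis inv_f_f)
  \<comment> \<open>The inverse is taken on the whole space, so it agrees with \<open>\<lambda>\<close> near \<open>y\<close> even though the values
    of \<open>\<lambda>\<close> there might a priori lie far from \<open>\<lambda>(y)\<close>; a local inverse need not agree.\<close>
  have "(inv G has_derivative (\<lambda>h. - matrix_inv M *v h)) (at (G (lam y)))"
  proof (rule has_derivative_inverse_strong [where S = UNIV and f = G and x = "lam y"])
    show "continuous_on UNIV G"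
      unfolding G_def continuous_on_eq_continuous_within
      using constraint_map_has_derivative has_derivative_continuous by blast
    show "(G has_derivative (\<lambda>h. - (M *v h))) (at (lam y))"
      unfolding G_def M_def by (rule constraint_map_has_derivative)
    have "- matrix_inv M *v h = - (matrix_inv M *v h)" for h
      by (simp add: vec_eq_iff matrix_vector_mult_def sum_negf)
    then have "- (M *v (- matrix_inv M *v h)) = (M ** matrix_inv M) *v h" for h
      by (simp add: linear_neg [OF matrix_vector_mul_linear] matrix_vector_mul_assoc)
    then show "(\<lambda>h. - (M *v h)) \<circ> (\<lambda>h. - matrix_inv M *v h) = id"
      by (simp add: fun_eq_iff invertible_matrix_inv(1) [OF M_inv])
  qed (use inj in auto)
  then have deriv: "(lam has_derivative (\<lambda>h. - matrix_inv M *v h)) (at y)"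
    using has_derivative_transform_within_open [OF _ assms(2,4) inv_G] G_lam [OF assms(4)]
    by simp
  then have "jacobian lam (at y) = - matrix_inv M"
    by (simp add: jacobian_def frechet_derivative_at [symmetric] matrix_of_matrix_vector_mul)
  moreover have "transpose (- matrix_inv M) = - transpose (matrix_inv M)"
    by (simp add: transpose_def vec_eq_iff)
  ultimately have "transpose (jacobian lam (at y)) = - matrix_inv M"
    using transpose_matrix_inv_of_symmetric [OF M_inv M_sym] by simp
  moreover have "lam differentiable (at y)"
    using deriv unfolding differentiable_def by blast
  ultimately show ?thesis
    by (simp add: M_def)
qed

end
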